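(* Let $A_t\in\mathbb{R}^{d\times d}$ be the (symmetric positive definite) regularized design matrix and $b_t\in\mathbb{R}^d$ the reward vector defined in the context, regarded as fixed, and let $\hat\theta_t=A_t^{-1}b_t$. Let $v>0$ and $\sigma>0$, let $\eta\sim\mathcal{N}(0,\sigma^2I_d)$ be privacy noise and $\xi\sim\mathcal{N}(0,v^2A_t^{-1})$ be the Thompson Sampling noise, with $\eta$ and $\xi$ independent. Put $\tilde b_t=b_t+\eta$. Then the Thompson Sampling sample based on $\tilde b_t$ satisfies $$\tilde\theta_t=A_t^{-1}\tilde b_t+\xi\;\sim\;\mathcal{N}\bigl(\hat\theta_t,\;v^2A_t^{-1}+\sigma^2A_t^{-2}\bigr).$$
   Context: For chosen-arm feature vectors $x_{a_s}\in\mathbb{R}^d$ and rewards $r_s\in[0,1]$, $s=1,\dots,t-1$, and ridge parameter $\lambda>0$, set $A_t=\lambda I_d+\sum_{s=1}^{t-1}x_{a_s}x_{a_s}^\top$ and $b_t=\sum_{s=1}^{t-1}r_sx_{a_s}$. Here $A_t^{-2}=A_t^{-1}A_t^{-1}$. *)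

theory Defs
  imports "HOL-Probability.Probability"
begin

definition outer_product :: "real ^ 'd \<Rightarrow> real ^ 'd \<Rightarrow> real ^ 'd ^ 'd" where
  "outer_product u w = (\<chi> i j. u $ i * w $ j)"

definition design_matrix ::
    "real \<Rightarrow> ('arm \<Rightarrow> real ^ 'd) \<Rightarrow> (nat \<Rightarrow> 'arm) \<Rightarrow> nat \<Rightarrow> real ^ 'd ^ 'd" where
  "design_matrix l x a t = l *\<^sub>R mat 1 + (\<Sum>s\<in>{1..<t}. outer_product (x (a s)) (x (a s)))"

definition reward_vector ::
    "('arm \<Rightarrow> real ^ 'd) \<Rightarrow> (nat \<Rightarrow> 'arm) \<Rightarrow> (nat \<Rightarrow> real) \<Rightarrow> nat \<Rightarrow> real ^ 'd" where
  "reward_vector x a r t = (\<Sum>s\<in>{1..<t}. r s *\<^sub>R x (a s))"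

definition sym_positive_definite :: "real ^ 'd ^ 'd \<Rightarrow> bool" where
  "sym_positive_definite S \<longleftrightarrow> transpose S = S \<and> (\<forall>y. y \<noteq> 0 \<longrightarrow> y \<bullet> (S *v y) > 0)"

definition multivariate_normal_density ::
    "real ^ 'd \<Rightarrow> real ^ 'd ^ 'd \<Rightarrow> real ^ 'd \<Rightarrow> real" where
  "multivariate_normal_density m S y =
     1 / sqrt ((2 * pi) ^ CARD('d) * det S) *
     exp (- ((y - m) \<bullet> (matrix_inv S *v (y - m))) / 2)"

(* The random vector X on M has the (nondegenerate) Gaussian law N(m, S).  The covariance S is
   required to be symmetric positive definite; otherwise the density formula is meaningless. *)
definition multivariate_normal ::
    "'w measure \<Rightarrow> ('w \<Rightarrow> real ^ 'd) \<Rightarrow> real ^ 'd \<Rightarrow> real ^ 'd ^ 'd \<Rightarrow> bool" where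
  "multivariate_normal M X m S \<longleftrightarrow>
     sym_positive_definite S \<and>
     distributed M lborel X (\<lambda>y. ennreal (multivariate_normal_density m S y))"

end

theory Submission
  imports Defs
begin

text \<open>Write \<open>B = A\<^sup>-\<^sup>1\<close>. Then \<open>\<theta>_tilde = (B b + B \<eta>) + \<xi>\<close> is a sum of two independent Gaussian vectors,
  the first being the image of \<open>\<eta>\<close> under an invertible affine map, with covariance
  \<open>B (\<sigma>\<^sup>2 I) B\<^sup>T = \<sigma>\<^sup>2 B\<^sup>2\<close>. Densities of affine images come from the linear change of variables, and
  the density of the sum is a convolution, evaluated by completing the square. The remaining Gaussian
  integral is reduced to the standard one by a basis that is orthonormal for the quadratic form.\<close>

subsection \<open>Linear change of variables\<close>

text \<open>The versions of the change of variables formula in \<^theory>\<open>HOL-Analysis.Change_Of_Vars\<close> require a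
  well-ordered index type.\<close>

lemma prod_Basis_cart: "(\<Prod>b\<in>Basis. f (b :: real ^ 'n)) = (\<Prod>i\<in>UNIV. f (axis i 1))"
proof -
  have B: "(Basis :: (real ^ 'n) set) = range (\<lambda>i. axis i 1)"
    by (auto simp: Basis_vec_def)
  have "inj (\<lambda>i::'n. axis i (1::real))"
    by (auto simp: inj_on_def axis_eq_axis)
  then show ?thesis
    unfolding B by (simp add: prod.reindex)
qed

lemma lborel_distr_translation:
  "distr lborel borel ((+) t) = (lborel :: 'a::euclidean_space measure)"
  using lborel_affine[of 1 t] by (simp add: density_1)

lemma nn_integral_lborel_translation:
  fixes f :: "'a::euclidean_space \<Rightarrow> ennreal"
  assumes [measurable]: "f \<in> borel_measurable borel"
  shows "(\<integral>\<^sup>+x. f (t + x) \<partial>lborel) = (\<integral>\<^sup>+x. f x \<partial>lborel)"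
  by (subst (2) lborel_distr_translation[symmetric, of t]) (simp add: nn_integral_distr)

text \<open>Fubini: with all other coordinates held fixed, the map translates the
  \<open>e\<close>-coordinate by an amount that does not depend on that coordinate, because
  \<open>w\<close> is orthogonal to \<open>e\<close>. Translation invariance on the line finishes
  the argument.\<close>

lemma nn_integral_lborel_shear:
  fixes f :: "'a::euclidean_space \<Rightarrow> ennreal"
  assumes [measurable]: "f \<in> borel_measurable borel" and e: "e \<in> Basis" and w: "w \<bullet> e = 0"
  shows "(\<integral>\<^sup>+x. f (x + (w \<bullet> x) *\<^sub>R e) \<partial>lborel) = (\<integral>\<^sup>+x. f x \<partial>lborel)"
proof -
  interpret product_sigma_finite "\<lambda>_::'a. lborel :: real measure" ..
  let ?J = "Basis - {e}"
  let ?s = "\<lambda>x. \<Sum>b\<in>?J. x b *\<^sub>R b"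
  have J: "Basis = insert e ?J" "finite ?J" "e \<notin> ?J"
    using e by auto
  \<comment> \<open>\<open>lborel\<close> is the image of a product measure, so the coordinate along
    \<open>e\<close> can be integrated innermost, with the others indexed by
    \<open>?J\<close>.\<close>
  have split: "(\<integral>\<^sup>+x. h x \<partial>lborel) =
      (\<integral>\<^sup>+x. \<integral>\<^sup>+y. h (?s x + y *\<^sub>R e) \<partial>lborel \<partial>Pi\<^sub>M ?J (\<lambda>_. lborel))"
    if [measurable]: "h \<in> borel_measurable borel" for h :: "'a \<Rightarrow> ennreal"
  proof -
    have upd: "(\<Sum>b\<in>Basis. (x(e := y)) b *\<^sub>R b) = ?s x + y *\<^sub>R e" for x and y :: real
      using e by (simp add: sum.remove[of _ e] add.commute)
    have "(\<integral>\<^sup>+x. h x \<partial>lborel) = (\<integral>\<^sup>+x. h (\<Sum>b\<in>Basis. x b *\<^sub>R b) \<partial>Pi\<^sub>M Basis (\<lambda>_. lborel))"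
      by (simp add: lborel_def[where 'a='a] nn_integral_distr lborel_eq_real[symmetric])
    also have "\<dots> = (\<integral>\<^sup>+x. h (\<Sum>b\<in>Basis. x b *\<^sub>R b) \<partial>Pi\<^sub>M (insert e ?J) (\<lambda>_. lborel))"
      using J(1) by simp
    also have "\<dots> = (\<integral>\<^sup>+x. \<integral>\<^sup>+y. h (\<Sum>b\<in>Basis. (x(e := y)) b *\<^sub>R b) \<partial>lborel \<partial>Pi\<^sub>M ?J (\<lambda>_. lborel))"
      using J by (intro product_nn_integral_insert) (auto simp flip: J(1))
    finally show ?thesis
      unfolding upd .
  qed
  have shift: "(\<integral>\<^sup>+y. h (?s x + y *\<^sub>R e + (w \<bullet> (?s x + y *\<^sub>R e)) *\<^sub>R e) \<partial>lborel) =
      (\<integral>\<^sup>+y. h (?s x + y *\<^sub>R e) \<partial>lborel)"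
    if [measurable]: "h \<in> borel_measurable borel" for h :: "'a \<Rightarrow> ennreal" and x
  proof -
    have *: "?s x + y *\<^sub>R e + (w \<bullet> (?s x + y *\<^sub>R e)) *\<^sub>R e = ?s x + (w \<bullet> ?s x + y) *\<^sub>R e" for y
      by (simp add: inner_add_right w algebra_simps)
    show ?thesis
      unfolding * using nn_integral_lborel_translation[of "\<lambda>y. h (?s x + y *\<^sub>R e)" "w \<bullet> ?s x"] by simp
  qed
  show ?thesis
    by (simp add: split shift)
qed

lemma borel_measurable_matrix_vector_mult[measurable]:
  fixes C :: "real ^ 'n ^ 'm"
  shows "(*v) C \<in> borel_measurable borel"
  by (intro borel_measurable_continuous_onI continuous_intros)

text \<open>A diagonal matrix scales each basis vector \<open>b\<close> by \<open>c b\<close>, the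
  situation of \<open>lborel_affine_euclidean\<close>; the product of the scaling factors is the
  determinant.\<close>

lemma nn_integral_lborel_diagonal:
  fixes A :: "real ^ 'n ^ 'n"
  assumes diag: "\<And>i j. i \<noteq> j \<Longrightarrow> A $ i $ j = 0" and nz: "det A \<noteq> 0"
    and f[measurable]: "f \<in> borel_measurable borel"
  shows "(\<integral>\<^sup>+x. f x \<partial>lborel) = ennreal \<bar>det A\<bar> * (\<integral>\<^sup>+x. f (A *v x) \<partial>lborel)"
proof -
  define c where "c b = b \<bullet> (A *v b)" for b
  have c: "c (axis i 1) = A $ i $ i" for i
    by (simp add: c_def inner_axis' matrix_vector_mult_basis column_def)
  have det: "det A = (\<Prod>b\<in>Basis. c b)"
    by (simp add: det_diagonal diag prod_Basis_cart c)
  have A_basis: "A *v b = c b *\<^sub>R b" if b: "b \<in> Basis" for b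
  proof -
    obtain i where b: "b = axis i 1"
      using b by (auto simp: Basis_vec_def)
    then show ?thesis
      using diag unfolding b c by (simp add: matrix_vector_mult_basis column_def vec_eq_iff) (auto simp: axis_def)
  qed
  have Ax: "A *v x = (\<Sum>j\<in>Basis. (c j * (x \<bullet> j)) *\<^sub>R j)" for x
  proof -
    have "A *v x = A *v (\<Sum>j\<in>Basis. (x \<bullet> j) *\<^sub>R j)"
      by (simp add: euclidean_representation)
    also have "\<dots> = (\<Sum>j\<in>Basis. (x \<bullet> j) *\<^sub>R (A *v j))"
      by (simp add: linear_sum[OF matrix_vector_mul_linear] matrix_vector_mult_scaleR)
    finally show ?thesis
      by (simp add: A_basis mult.commute)
  qed
  have "c j \<noteq> 0" if "j \<in> Basis" for j
    using nz that by (simp add: det)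
  then have "lborel = density (distr lborel borel (\<lambda>x. 0 + (\<Sum>j\<in>Basis. (c j * (x \<bullet> j)) *\<^sub>R j)))
      (\<lambda>_. \<Prod>j\<in>Basis. \<bar>c j\<bar>)"
    by (rule lborel_affine_euclidean)
  then have eq: "lborel = density (distr lborel borel ((*v) A)) (\<lambda>_. ennreal \<bar>det A\<bar>)"
    by (simp add: Ax[symmetric] det abs_prod)
  show "(\<integral>\<^sup>+x. f x \<partial>lborel) = ennreal \<bar>det A\<bar> * (\<integral>\<^sup>+x. f (A *v x) \<partial>lborel)"
    by (subst eq) (simp add: nn_integral_density nn_integral_distr nn_integral_cmult)
qed

text \<open>Lebesgue measure is determined by its values on boxes, and exchanging two coordinates
  sends a box to one with the same side lengths in another order.\<close>

lemma nn_integral_lborel_transposition: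
  fixes m n :: "'n::finite" and f :: "real ^ 'n \<Rightarrow> ennreal"
  defines "A \<equiv> (\<chi> i j. mat 1 $ i $ Transposition.transpose m n j)"
  assumes "f \<in> borel_measurable borel"
  shows "(\<integral>\<^sup>+x. f x \<partial>lborel) = (\<integral>\<^sup>+x. f (A *v x) \<partial>lborel)"
proof -
  let ?t = "Transposition.transpose m n"
  have A: "(A *v x) $ i = x $ ?t i" for x i
  proof -
    have "(A *v x) $ i = (\<Sum>j\<in>UNIV. if j = ?t i then x $ j else 0)"
      unfolding A_def matrix_vector_mult_def mat_def vec_lambda_beta
      by (intro sum.cong) (auto simp: transpose_eq_iff)
    then show ?thesis
      by simp
  qed
  have "lborel = distr lborel borel ((*v) A)"
  proof (rule lborel_eqI)
    fix l u :: "real ^ 'n"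
    assume le: "\<And>b. b \<in> Basis \<Longrightarrow> l \<bullet> b \<le> u \<bullet> b"
    have lu: "l $ i \<le> u $ i" for i
      using le[of "axis i 1"] by (simp add: inner_axis axis_in_Basis_iff)
    have "(*v) A -` box l u = box (A *v l) (A *v u)"
      unfolding mem_box_cart set_eq_iff vimage_eq A
      by (metis transpose_involutory)
    then have "emeasure (distr lborel borel ((*v) A)) (box l u) =
        emeasure lborel (box (A *v l) (A *v u))"
      by (simp add: emeasure_distr)
    also have "\<dots> = (\<Prod>b\<in>Basis. (A *v u - A *v l) \<bullet> b)"
      by (rule emeasure_lborel_box) (auto simp: Basis_vec_def inner_axis A lu)
    also have "(\<Prod>b\<in>Basis. (A *v u - A *v l) \<bullet> b) = (\<Prod>i\<in>UNIV. (u - l) $ ?t i)"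
      by (simp add: prod_Basis_cart inner_axis A)
    also have "\<dots> = (\<Prod>i\<in>UNIV. (u - l) $ i)"
      by (rule prod.permute[OF permutes_swap_id, symmetric, unfolded o_def]) auto
    also have "\<dots> = (\<Prod>b\<in>Basis. (u - l) \<bullet> b)"
      by (simp add: prod_Basis_cart inner_axis)
    finally show "emeasure (distr lborel borel ((*v) A)) (box l u) = (\<Prod>b\<in>Basis. (u - l) \<bullet> b)" .
  qed simp
  then have "(\<integral>\<^sup>+x. f x \<partial>lborel) = (\<integral>\<^sup>+x. f x \<partial>distr lborel borel ((*v) A))"
    by (rule arg_cong)
  also have "\<dots> = (\<integral>\<^sup>+x. f (A *v x) \<partial>lborel)"
    by (simp add: nn_integral_distr assms(2))
  finally show ?thesis .
qed

text \<open>Adding coordinate \<open>n\<close> to coordinate \<open>m\<close> is the shear with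
  \<open>w = axis n 1\<close> and \<open>e = axis m 1\<close>.\<close>

lemma nn_integral_lborel_shear_matrix:
  fixes m n :: "'n::finite" and f :: "real ^ 'n \<Rightarrow> ennreal"
  defines "A \<equiv> (\<chi> i j. of_bool (i = m \<and> j = n \<or> i = j))"
  assumes mn: "m \<noteq> n" and f: "f \<in> borel_measurable borel"
  shows "(\<integral>\<^sup>+x. f x \<partial>lborel) = (\<integral>\<^sup>+x. f (A *v x) \<partial>lborel)"
proof -
  have "A *v x = x + (axis n 1 \<bullet> x) *\<^sub>R axis m 1" for x
  proof -
    have "(A *v x) $ i = (\<Sum>j\<in>UNIV. (if j = i then x $ j else 0) + (if j = n then of_bool (i = m) * x $ j else 0))" for i
      unfolding matrix_vector_mult_def A_def vec_lambda_beta using mn by (intro sum.cong) auto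
    then show ?thesis
      by (simp add: vec_eq_iff sum.distrib inner_axis') (simp add: axis_def)
  qed
  moreover have "axis n 1 \<bullet> (axis m 1 :: real ^ 'n) = 0"
    using mn by (simp add: inner_axis_axis)
  ultimately show ?thesis
    by (simp add: nn_integral_lborel_shear[OF f] axis_in_Basis_iff)
qed

text \<open>Every square matrix is a product of matrices with a zero row, diagonal matrices,
  transpositions and shears, and the formula is stable under products because determinants
  multiply.\<close>

lemma nn_integral_lborel_matrix:
  fixes C :: "real ^ 'n ^ 'n"
  assumes "det C \<noteq> 0" "f \<in> borel_measurable borel"
  shows "(\<integral>\<^sup>+x. f x \<partial>lborel) = ennreal \<bar>det C\<bar> * (\<integral>\<^sup>+x. f (C *v x) \<partial>lborel)"
proof -
  \<comment> \<open>The guard \<open>det C \<noteq> 0\<close> makes the zero-row case vacuous and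
    passes to both factors of a product. Quantifying over \<open>f\<close> inside \<open>P\<close>
    lets the hypothesis for \<open>B\<close> be applied to \<open>f\<close> composed with
    \<open>A\<close>.\<close>
  define P where "P C \<longleftrightarrow> (det C \<noteq> 0 \<longrightarrow> (\<forall>f\<in>borel_measurable borel.
      (\<integral>\<^sup>+x. f x \<partial>lborel) = ennreal \<bar>det C\<bar> * (\<integral>\<^sup>+x. f (C *v x) \<partial>lborel)))"
    for C :: "real ^ 'n ^ 'n"
  have "P C"
  proof (rule induct_matrix_elementary_alt)
    fix A B :: "real ^ 'n ^ 'n"
    assume A: "P A" and B: "P B"
    show "P (A ** B)"
      unfolding P_def
    proof (intro impI ballI)
      fix f :: "real ^ 'n \<Rightarrow> ennreal"
      assume nz: "det (A ** B) \<noteq> 0" and f[measurable]: "f \<in> borel_measurable borel"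
      have nz': "det A \<noteq> 0" "det B \<noteq> 0"
        using nz by (auto simp: det_mul)
      have "(\<integral>\<^sup>+x. f x \<partial>lborel) = ennreal \<bar>det A\<bar> * (\<integral>\<^sup>+x. f (A *v x) \<partial>lborel)"
        using A[unfolded P_def, rule_format, OF nz'(1) f] .
      also have "(\<integral>\<^sup>+x. f (A *v x) \<partial>lborel) = ennreal \<bar>det B\<bar> * (\<integral>\<^sup>+x. f (A *v (B *v x)) \<partial>lborel)"
        by (rule B[unfolded P_def, rule_format, OF nz'(2)]) measurable
      finally show "(\<integral>\<^sup>+x. f x \<partial>lborel) =
          ennreal \<bar>det (A ** B)\<bar> * (\<integral>\<^sup>+x. f (A ** B *v x) \<partial>lborel)"
        by (simp add: det_mul abs_mult ennreal_mult matrix_vector_mul_assoc mult.assoc)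
    qed
  next
    fix A :: "real ^ 'n ^ 'n" and i
    assume "row i A = 0"
    then show "P A"
      by (simp add: P_def det_zero_row)
  next
    fix A :: "real ^ 'n ^ 'n"
    assume "\<And>i j. i \<noteq> j \<Longrightarrow> A $ i $ j = 0"
    then show "P A"
      unfolding P_def by (blast intro: nn_integral_lborel_diagonal)
  next
    fix m n :: 'n
    assume mn: "m \<noteq> n"
    have "\<bar>det ((\<chi> i j. mat 1 $ i $ Transposition.transpose m n j) :: real ^ 'n ^ 'n)\<bar> = 1"
      using mn by (simp add: det_permute_columns permutes_swap_id sign_swap_id)
    then show "P (\<chi> i j. mat 1 $ i $ Transposition.transpose m n j)"
      unfolding P_def by (auto intro: nn_integral_lborel_transposition)
  next
    fix m n :: 'n
    assume mn: "m \<noteq> n"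
    let ?A = "(\<chi> i j. of_bool (i = m \<and> j = n \<or> i = j)) :: real ^ 'n ^ 'n"
    \<comment> \<open>The shear is the identity matrix after adding row \<open>n\<close> to row
      \<open>m\<close>, which leaves the determinant at 1.\<close>
    have row: "?A = (\<chi> k. if k = m then row m (mat 1) + 1 *s row n (mat 1) else row k (mat 1))"
      using mn by (auto simp: vec_eq_iff row_def mat_def)
    have "det ?A = 1"
      unfolding row det_row_operation[OF mn] by (rule det_I)
    then show "P ?A"
      unfolding P_def by (auto intro: nn_integral_lborel_shear_matrix[OF mn] simp del: of_bool_or_iff)
  qed
  with assms show ?thesis
    unfolding P_def by blast
qed

subsection \<open>Symmetric positive definite matrices\<close>

lemma matrix_inv_mult:
  assumes "invertible A"
  shows matrix_inv_right: "A ** matrix_inv A = mat 1" and matrix_inv_left: "matrix_inv A ** A = mat 1"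
  using someI_ex[OF assms[unfolded invertible_def]] by (simp_all add: matrix_inv_def)

lemma matrix_inv_vector:
  assumes "invertible A"
  shows matrix_inv_vector_right: "A *v (matrix_inv A *v x) = x"
    and matrix_inv_vector_left: "matrix_inv A *v (A *v x) = x"
  using matrix_inv_mult[OF assms] by (simp_all add: matrix_vector_mul_assoc)

lemma inner_matrix_vector_transpose:
  fixes A :: "real ^ 'n ^ 'm"
  shows "(A *v x) \<bullet> y = x \<bullet> (transpose A *v y)"
  by (metis dot_lmul_matrix inner_commute transpose_matrix_vector)

lemma transpose_add: "transpose (A + B) = transpose A + transpose B"
  by (simp add: transpose_def vec_eq_iff)

lemma sym_positive_definiteD:
  assumes "sym_positive_definite S"
  shows "transpose S = S" and "y \<noteq> 0 \<Longrightarrow> y \<bullet> (S *v y) > 0"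
  using assms by (auto simp: sym_positive_definite_def)

lemma sym_positive_definite_inner_swap:
  assumes "sym_positive_definite S"
  shows "(S *v x) \<bullet> y = x \<bullet> (S *v y)"
  by (simp add: inner_matrix_vector_transpose sym_positive_definiteD(1)[OF assms])

lemma sym_positive_definite_add:
  assumes "sym_positive_definite S" "sym_positive_definite T"
  shows "sym_positive_definite (S + T)"
  using assms
  by (auto simp: sym_positive_definite_def transpose_add matrix_vector_mult_add_rdistrib inner_add_right
      intro!: add_pos_pos)

text \<open>The form at \<open>y\<close> is the form of \<open>S\<close> at
  \<open>transpose C *v y\<close>, and this vector is nonzero for nonzero \<open>y\<close> because
  \<open>transpose C\<close> is injective.\<close>

lemma sym_positive_definite_congruence:
  fixes C S :: "real ^ 'n ^ 'n"
  assumes S: "sym_positive_definite S" and C: "invertible C"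
  shows "sym_positive_definite (C ** S ** transpose C)"
  unfolding sym_positive_definite_def
proof (intro conjI allI impI)
  show "transpose (C ** S ** transpose C) = C ** S ** transpose C"
    by (simp add: matrix_transpose_mul matrix_mul_assoc sym_positive_definiteD(1)[OF S])
  fix y :: "real ^ 'n"
  assume "y \<noteq> 0"
  then have "transpose C *v y \<noteq> 0"
    using inj_matrix_vector_mult[OF transpose_invertible[OF C]]
    by (metis injD matrix_vector_mult_0_right)
  then have "0 < (transpose C *v y) \<bullet> (S *v (transpose C *v y))"
    by (rule sym_positive_definiteD(2)[OF S])
  then show "0 < y \<bullet> (C ** S ** transpose C *v y)"
    by (simp only: inner_matrix_vector_transpose transpose_transpose matrix_vector_mul_assoc matrix_mul_assoc)
qed

lemma sym_positive_definite_invertible: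
  assumes "sym_positive_definite S"
  shows "invertible S"
proof -
  have "\<forall>x. S *v x = 0 \<longrightarrow> x = 0"
    using sym_positive_definiteD(2)[OF assms] by force
  then show ?thesis
    by (simp add: invertible_left_inverse matrix_left_invertible_ker)
qed

text \<open>The inverse is the congruence of \<open>S\<close> by \<open>matrix_inv S\<close>: once
  the inverse is known to be symmetric, the triple product collapses to
  \<open>matrix_inv S\<close>.\<close>

lemma sym_positive_definite_matrix_inv:
  assumes S: "sym_positive_definite S"
  shows "sym_positive_definite (matrix_inv S)"
proof -
  note inv = sym_positive_definite_invertible[OF S]
  have "invertible (matrix_inv S)"
    using matrix_inv_mult[OF inv] by (auto simp: invertible_def)
  moreover have "transpose (matrix_inv S) = matrix_inv S"
  proof -
    \<comment> \<open>The transposed inverse is also a left inverse of \<open>S\<close>, hence equal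
      to the two-sided one.\<close>
    have "transpose (matrix_inv S) ** S = transpose (S ** matrix_inv S)"
      by (simp only: matrix_transpose_mul sym_positive_definiteD(1)[OF S])
    then have "transpose (matrix_inv S) ** S = mat 1"
      by (simp add: matrix_inv_right[OF inv])
    then have "transpose (matrix_inv S) ** S ** matrix_inv S = matrix_inv S"
      by simp
    then show ?thesis
      by (simp add: matrix_inv_right[OF inv] flip: matrix_mul_assoc)
  qed
  ultimately show ?thesis
    using sym_positive_definite_congruence[OF S, of "matrix_inv S"] by (simp add: matrix_inv_left[OF inv])
qed

text \<open>Gram--Schmidt for the inner product \<open>x \<bullet> (S *v y)\<close>.\<close>
lemma sym_positive_definite_orthonormal_set:
  fixes S :: "real ^ 'n ^ 'n"
  assumes S: "sym_positive_definite S" and "k \<le> CARD('n)"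
  shows "\<exists>V. finite V \<and> card V = k \<and> (\<forall>x\<in>V. \<forall>y\<in>V. x \<bullet> (S *v y) = of_bool (x = y))"
  using \<open>k \<le> CARD('n)\<close>
proof (induction k)
  case 0
  show ?case
    by (rule exI[of _ "{}"]) simp
next
  case (Suc k)
  then obtain V where V: "finite V" "card V = k" "\<forall>x\<in>V. \<forall>y\<in>V. x \<bullet> (S *v y) = of_bool (x = y)"
    by auto
  \<comment> \<open>Fewer than \<open>CARD('n)\<close> vectors cannot span, so some nonzero
    \<open>w\<close> is Euclidean-orthogonal to every \<open>S *v y\<close> with \<open>y\<close> in
    \<open>V\<close>; this is orthogonality to \<open>V\<close> for the form of \<open>S\<close>.
    Dividing by \<open>sqrt q\<close> normalises it.\<close>
  have "dim ((*v) S ` V) \<le> card ((*v) S ` V)"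
    using V(1) by (intro dim_le_card') auto
  also have "\<dots> \<le> k"
    using V(1,2) card_image_le by blast
  also have "\<dots> < DIM(real ^ 'n)"
    using Suc.prems by simp
  finally obtain w where w: "w \<noteq> 0" "\<And>y. y \<in> span ((*v) S ` V) \<Longrightarrow> orthogonal w y"
    by (rule orthogonal_to_subspace_exists) blast
  define q where "q = w \<bullet> (S *v w)"
  have q: "q > 0"
    using sym_positive_definiteD(2)[OF S w(1)] by (simp add: q_def)
  define u where "u = (1 / sqrt q) *\<^sub>R w"
  have uu: "u \<bullet> (S *v u) = 1"
    using q by (simp add: u_def matrix_vector_mult_scaleR flip: q_def)
  have uy: "u \<bullet> (S *v y) = 0" if "y \<in> V" for y
    using w(2)[of "S *v y"] that by (simp add: u_def span_base orthogonal_def)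
  then have yu: "y \<bullet> (S *v u) = 0" if "y \<in> V" for y
    using that sym_positive_definite_inner_swap[OF S, of y u] by (simp add: inner_commute)
  have "u \<notin> V"
    using uu uy by force
  then show ?case
    using V uu uy yu by (intro exI[of _ "insert u V"]) auto
qed

text \<open>The columns of \<open>C\<close> form a basis orthonormal for the form of
  \<open>S\<close>, and entry (i, j) of the product is \<open>c i \<bullet> (S *v c j)\<close>.
  Substituting \<open>C *v x\<close> therefore turns the form into
  \<open>x \<bullet> x\<close>.\<close>

lemma sym_positive_definite_diagonalize:
  fixes S :: "real ^ 'n ^ 'n"
  assumes "sym_positive_definite S"
  obtains C :: "real ^ 'n ^ 'n" where "transpose C ** S ** C = mat 1"
proof -
  obtain V where V: "finite V" "card V = CARD('n)" "\<forall>x\<in>V. \<forall>y\<in>V. x \<bullet> (S *v y) = of_bool (x = y)"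
    using sym_positive_definite_orthonormal_set[OF assms order_refl] by auto
  then obtain c :: "'n \<Rightarrow> real ^ 'n" where c: "bij_betw c UNIV V"
    by (metis finite_class.finite_UNIV finite_same_card_bij)
  define C where "C = transpose (\<chi> i. c i)"
  have "(transpose C ** S ** C) $ i $ j = mat 1 $ i $ j" for i j
  proof -
    have "(transpose C ** S ** C) $ i $ j = axis i 1 \<bullet> ((transpose C ** S ** C) *v axis j 1)"
      by (simp add: inner_axis' matrix_vector_mult_basis column_def)
    also have "\<dots> = axis i 1 \<bullet> (transpose C *v (S *v (C *v axis j 1)))"
      by (simp only: matrix_vector_mul_assoc matrix_mul_assoc)
    also have "\<dots> = (C *v axis i 1) \<bullet> (S *v (C *v axis j 1))"
      by (simp only: inner_matrix_vector_transpose)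
    also have "\<dots> = c i \<bullet> (S *v c j)"
      by (simp add: matrix_vector_mult_basis C_def row_def vec_lambda_eta)
    also have "\<dots> = of_bool (c i = c j)"
      using V(3) c by (auto simp: bij_betw_def)
    also have "\<dots> = of_bool (i = j)"
      using c by (auto simp: bij_betw_def inj_on_def)
    finally show ?thesis
      by (simp add: mat_def)
  qed
  then show thesis
    by (intro that[of C]) (simp add: vec_eq_iff)
qed

lemma det_congruence:
  fixes C S :: "real ^ 'n ^ 'n"
  shows "det (transpose C ** S ** C) = (det C)\<^sup>2 * det S"
  by (simp add: det_mul power2_eq_square)

lemma sym_positive_definite_det_pos:
  fixes S :: "real ^ 'n ^ 'n"
  assumes "sym_positive_definite S"
  shows "det S > 0"
proof -
  obtain C :: "real ^ 'n ^ 'n" where "transpose C ** S ** C = mat 1"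
    using sym_positive_definite_diagonalize[OF assms] .
  then have "(det C)\<^sup>2 * det S = 1"
    using det_congruence[of C S] by simp
  then have "0 < (det C)\<^sup>2 * det S"
    by simp
  then show ?thesis
    by (meson mult_nonneg_nonpos not_less zero_le_power2)
qed

subsection \<open>Gaussian vectors\<close>

text \<open>The integrand factors over the coordinates, and each factor integrates to
  \<open>sqrt (2 * pi)\<close> because the standard normal density has mass 1.\<close>

lemma nn_integral_gaussian_norm:
  "(\<integral>\<^sup>+x. ennreal (exp (- (x \<bullet> x / 2))) \<partial>(lborel :: (real ^ 'n) measure)) = ennreal (sqrt (2 * pi) ^ CARD('n))"
proof -
  have one: "(\<integral>\<^sup>+t. ennreal (exp (- (t\<^sup>2 / 2))) \<partial>lborel) = ennreal (sqrt (2 * pi))"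
  proof -
    have "(\<integral>\<^sup>+t. ennreal (exp (- (t\<^sup>2 / 2))) \<partial>lborel) =
        (\<integral>\<^sup>+t. ennreal (sqrt (2 * pi)) * ennreal (std_normal_density t) \<partial>lborel)"
      by (intro nn_integral_cong) (simp add: std_normal_density_def flip: ennreal_mult)
    also have "\<dots> = ennreal (sqrt (2 * pi)) * (\<integral>\<^sup>+t. ennreal (std_normal_density t) \<partial>lborel)"
      by (simp add: nn_integral_cmult)
    also have "(\<integral>\<^sup>+t. ennreal (std_normal_density t) \<partial>lborel) = 1"
      by (subst nn_integral_eq_integral) auto
    finally show ?thesis
      by simp
  qed
  have "exp (- (x \<bullet> x / 2)) = (\<Prod>b\<in>Basis. exp (- (x \<bullet> b)\<^sup>2 / 2))" for x :: "real ^ 'n"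
    by (subst euclidean_inner)
      (simp add: exp_sum[symmetric] sum_divide_distrib sum_negf power2_eq_square)
  then have "(\<integral>\<^sup>+x. ennreal (exp (- (x \<bullet> x / 2))) \<partial>(lborel :: (real ^ 'n) measure)) =
      (\<integral>\<^sup>+x. (\<Prod>b\<in>Basis. ennreal (exp (- (x \<bullet> b)\<^sup>2 / 2))) \<partial>(lborel :: (real ^ 'n) measure))"
    by (simp add: prod_ennreal)
  also have "\<dots> = (\<Prod>b\<in>(Basis :: (real ^ 'n) set). ennreal (sqrt (2 * pi)))"
    by (subst nn_integral_lborel_prod) (simp_all add: one)
  also have "\<dots> = ennreal (sqrt (2 * pi) ^ CARD('n))"
    by (simp add: ennreal_power)
  finally show ?thesis .
qed

text \<open>Substituting \<open>C *v x\<close>, where \<open>C\<close> diagonalizes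
  \<open>S\<close>, leaves the standard integral; the Jacobian \<open>\<bar>det C\<bar>\<close>
  equals \<open>sqrt (1 / det S)\<close>.\<close>

lemma nn_integral_gaussian:
  fixes S :: "real ^ 'n ^ 'n"
  assumes S: "sym_positive_definite S"
  shows "(\<integral>\<^sup>+x. ennreal (exp (- (x \<bullet> (S *v x)) / 2)) \<partial>lborel) = ennreal (sqrt ((2 * pi) ^ CARD('n) / det S))"
proof -
  obtain C :: "real ^ 'n ^ 'n" where C: "transpose C ** S ** C = mat 1"
    using sym_positive_definite_diagonalize[OF S] .
  then have det: "(det C)\<^sup>2 * det S = 1"
    using det_congruence[of C S] by simp
  then have nz: "det C \<noteq> 0"
    by auto
  have absC: "\<bar>det C\<bar> = sqrt (1 / det S)"
  proof -
    have "(det C)\<^sup>2 = 1 / det S"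
      using det sym_positive_definite_det_pos[OF S] by (simp add: field_simps)
    then show ?thesis
      by (metis real_sqrt_abs)
  qed
  have quad: "(C *v x) \<bullet> (S *v (C *v x)) = x \<bullet> x" for x
    by (simp add: inner_matrix_vector_transpose matrix_vector_mul_assoc matrix_mul_assoc C)
  have "(\<integral>\<^sup>+x. ennreal (exp (- (x \<bullet> (S *v x)) / 2)) \<partial>lborel) =
      ennreal \<bar>det C\<bar> * (\<integral>\<^sup>+x. ennreal (exp (- (x \<bullet> x / 2))) \<partial>(lborel :: (real ^ 'n) measure))"
    by (subst nn_integral_lborel_matrix[OF nz])
      (auto simp: quad intro!: borel_measurable_continuous_onI continuous_intros measurable_compose[OF _ measurable_ennreal])
  also have "\<dots> = ennreal (sqrt ((2 * pi) ^ CARD('n) / det S))"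
    using sym_positive_definite_det_pos[OF S]
    by (simp add: nn_integral_gaussian_norm absC real_sqrt_divide real_sqrt_power real_sqrt_mult power_mult_distrib flip: ennreal_mult)
  finally show ?thesis .
qed

section \<open>Densities of invertible affine images\<close>

lemma borel_measurable_multivariate_normal_density[measurable]:
  "multivariate_normal_density m S \<in> borel_measurable borel"
  unfolding multivariate_normal_density_def
  by (intro borel_measurable_continuous_onI continuous_intros continuous_on_compose2[OF matrix_vector_mult_linear_continuous_on]) auto

lemma multivariate_normal_density_nonneg: "sym_positive_definite S \<Longrightarrow> 0 \<le> multivariate_normal_density m S y"
  by (simp add: multivariate_normal_density_def sym_positive_definite_det_pos less_imp_le)

text \<open>The hypothesis \<open>fg\<close> expresses the old density through the new one, so the
  two laws can be compared on each Borel set without writing down the inverse map.\<close>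

lemma distributed_lborel_affine_matrix:
  fixes C :: "real ^ 'n ^ 'n"
  assumes X: "distributed M lborel X f" and C: "det C \<noteq> 0"
    and g[measurable]: "g \<in> borel_measurable borel"
    and fg: "\<And>x. f x = ennreal \<bar>det C\<bar> * g (c + C *v x)"
  shows "distributed M lborel (\<lambda>\<omega>. c + C *v X \<omega>) g"
proof -
  have X_meas[measurable]: "X \<in> M \<rightarrow>\<^sub>M borel" and f[measurable]: "f \<in> borel_measurable borel"
    using distributed_measurable[OF X] distributed_borel_measurable[OF X] by simp_all
  have T[measurable]: "(\<lambda>x. c + C *v x) \<in> borel_measurable borel"
    by (intro borel_measurable_continuous_onI continuous_intros)
  have "distr M lborel (\<lambda>\<omega>. c + C *v X \<omega>) = density lborel g"
  proof (rule measure_eqI)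
    fix A :: "(real ^ 'n) set"
    assume "A \<in> sets (distr M lborel (\<lambda>\<omega>. c + C *v X \<omega>))"
    then have A[measurable]: "A \<in> sets borel"
      by simp
    have "emeasure (distr M lborel (\<lambda>\<omega>. c + C *v X \<omega>)) A = (\<integral>\<^sup>+\<omega>. indicator A (c + C *v X \<omega>) \<partial>M)"
      using nn_integral_distr[of "\<lambda>\<omega>. c + C *v X \<omega>" M lborel "indicator A"] by simp
    also have "\<dots> = (\<integral>\<^sup>+x. f x * indicator A (c + C *v x) \<partial>lborel)"
      by (rule distributed_nn_integral[OF X, symmetric]) simp
    also have "\<dots> = ennreal \<bar>det C\<bar> * (\<integral>\<^sup>+x. g (c + C *v x) * indicator A (c + C *v x) \<partial>lborel)"
      by (subst nn_integral_cmult[symmetric]) (simp_all add: fg mult.assoc)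
    \<comment> \<open>The change of variables absorbs the factor \<open>\<bar>det C\<bar>\<close>;
      translation invariance then removes the shift \<open>c\<close>.\<close>
    also have "\<dots> = (\<integral>\<^sup>+x. g (c + x) * indicator A (c + x) \<partial>lborel)"
      by (subst nn_integral_lborel_matrix[OF C, symmetric]) simp_all
    also have "\<dots> = (\<integral>\<^sup>+x. g x * indicator A x \<partial>lborel)"
      by (rule nn_integral_lborel_translation) simp
    finally show "emeasure (distr M lborel (\<lambda>\<omega>. c + C *v X \<omega>)) A = emeasure (density lborel g) A"
      by (simp add: emeasure_density)
  qed simp
  then show ?thesis
    by (simp add: distributed_def)
qed

text \<open>At corresponding points the exponents coincide, and the normalising constants differ by
  the factor \<open>\<bar>det C\<bar>\<close>, which is what the change of variables
  requires.\<close>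

lemma multivariate_normal_affine:
  fixes C S :: "real ^ 'n ^ 'n"
  assumes X: "multivariate_normal M X m S" and C: "invertible C"
  shows "multivariate_normal M (\<lambda>\<omega>. c + C *v X \<omega>) (c + C *v m) (C ** S ** transpose C)"
proof -
  have S: "sym_positive_definite S"
    using X by (simp add: multivariate_normal_def)
  let ?T = "C ** S ** transpose C"
  have T: "sym_positive_definite ?T"
    by (rule sym_positive_definite_congruence[OF S C])
  have detC: "det C \<noteq> 0"
    using C invertible_det_nz by blast
  have quad: "(C *v z) \<bullet> (matrix_inv ?T *v (C *v z)) = z \<bullet> (matrix_inv S *v z)" for z
  proof -
    \<comment> \<open>Cancelling \<open>C\<close> in \<open>?T *v w = C *v z\<close> leaves
      \<open>transpose C *v w = matrix_inv S *v z\<close>, so no formula for the inverse of a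
      product enters.\<close>
    define w where "w = matrix_inv ?T *v (C *v z)"
    have "?T *v w = C *v z"
      by (simp add: w_def matrix_inv_vector_right[OF sym_positive_definite_invertible[OF T]])
    then have "C *v (S *v (transpose C *v w)) = C *v z"
      by (simp only: matrix_vector_mul_assoc matrix_mul_assoc)
    then have "S *v (transpose C *v w) = z"
      using inj_matrix_vector_mult[OF C] by (simp add: inj_eq)
    then have "transpose C *v w = matrix_inv S *v z"
      using matrix_inv_vector_left[OF sym_positive_definite_invertible[OF S]] by metis
    then show ?thesis
      by (simp add: inner_matrix_vector_transpose flip: w_def)
  qed
  have det: "sqrt ((2 * pi) ^ CARD('n) * det ?T) = \<bar>det C\<bar> * sqrt ((2 * pi) ^ CARD('n) * det S)"
    by (simp add: det_mul real_sqrt_mult)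
  have "multivariate_normal_density m S x =
      \<bar>det C\<bar> * multivariate_normal_density (c + C *v m) ?T (c + C *v x)" for x
    unfolding multivariate_normal_density_def det using detC
    by (simp add: quad flip: matrix_vector_mult_diff_distrib)
  then have "distributed M lborel (\<lambda>\<omega>. c + C *v X \<omega>)
      (\<lambda>y. ennreal (multivariate_normal_density (c + C *v m) ?T y))"
    using X by (intro distributed_lborel_affine_matrix[OF _ detC])
      (auto simp: multivariate_normal_def ennreal_mult')
  then show ?thesis
    using T by (simp add: multivariate_normal_def)
qed

section \<open>Sums of independent vectors and convolution of densities\<close>

text \<open>By independence the law of the sum is the convolution of the two laws. Inserting the
  densities, translating the inner integral by \<open>y\<close> and exchanging the integrals
  exhibits its density.\<close>

lemma (in prob_space) distributed_convolution_euclidean: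
  fixes f g :: "'b::ordered_euclidean_space \<Rightarrow> ennreal"
  assumes indep: "indep_var borel X borel Y"
    and X: "distributed M lborel X f" and Y: "distributed M lborel Y g"
  shows "distributed M lborel (\<lambda>\<omega>. X \<omega> + Y \<omega>) (\<lambda>x. \<integral>\<^sup>+y. f (x - y) * g y \<partial>lborel)"
proof -
  have [measurable]: "f \<in> borel_measurable borel" "g \<in> borel_measurable borel"
    "random_variable borel X" "random_variable borel Y"
    using distributed_borel_measurable[OF X] distributed_borel_measurable[OF Y]
      distributed_measurable[OF X] distributed_measurable[OF Y] by simp_all
  have fin: "finite_measure (distr M borel X)" "finite_measure (distr M borel Y)"
    by (simp_all add: finite_measure_distr)
  have "distr M lborel (\<lambda>\<omega>. X \<omega> + Y \<omega>) = density lborel (\<lambda>x. \<integral>\<^sup>+y. f (x - y) * g y \<partial>lborel)"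
  proof (rule measure_eqI)
    fix A :: "'b set"
    assume "A \<in> sets (distr M lborel (\<lambda>\<omega>. X \<omega> + Y \<omega>))"
    then have A[measurable]: "A \<in> sets borel"
      by simp
    have "emeasure (distr M lborel (\<lambda>\<omega>. X \<omega> + Y \<omega>)) A = emeasure (distr M borel (\<lambda>\<omega>. X \<omega> + Y \<omega>)) A"
      by (simp cong: distr_cong)
    \<comment> \<open>The convolution is commuted so that \<open>Y\<close> belongs to the outer
      integral, matching \<open>g y\<close> in the claimed density.\<close>
    also have "\<dots> = emeasure (distr M borel Y \<star> distr M borel X) A"
      using fin by (simp add: sum_indep_random_variable[OF indep] convolution_commutative)
    also have "\<dots> = (\<integral>\<^sup>+y. \<integral>\<^sup>+x. indicator A (y + x) \<partial>distr M borel X \<partial>distr M borel Y)"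
      using fin by (intro convolution_emeasure') simp_all
    also have "\<dots> = (\<integral>\<^sup>+y. \<integral>\<^sup>+x. indicator A (y + x) \<partial>distr M lborel X \<partial>distr M lborel Y)"
      by (simp cong: distr_cong)
    also have "\<dots> = (\<integral>\<^sup>+y. g y * (\<integral>\<^sup>+x. f x * indicator A (y + x) \<partial>lborel) \<partial>lborel)"
      by (simp add: distributed_distr_eq_density[OF X] distributed_distr_eq_density[OF Y] nn_integral_density)
    also have "\<dots> = (\<integral>\<^sup>+y. \<integral>\<^sup>+x. f (x - y) * g y * indicator A x \<partial>lborel \<partial>lborel)"
    proof (rule nn_integral_cong)
      fix y
      have "(\<integral>\<^sup>+x. f x * indicator A (y + x) \<partial>lborel) = (\<integral>\<^sup>+x. f (x - y) * indicator A x \<partial>lborel)"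
        using nn_integral_lborel_translation[of "\<lambda>x. f (x - y) * indicator A x" y] by simp
      then show "g y * (\<integral>\<^sup>+x. f x * indicator A (y + x) \<partial>lborel) =
          (\<integral>\<^sup>+x. f (x - y) * g y * indicator A x \<partial>lborel)"
        by (simp add: nn_integral_cmult[symmetric] mult_ac)
    qed
    also have "\<dots> = (\<integral>\<^sup>+x. \<integral>\<^sup>+y. f (x - y) * g y * indicator A x \<partial>lborel \<partial>lborel)"
      by (intro lborel_pair.Fubini') simp
    finally show "emeasure (distr M lborel (\<lambda>\<omega>. X \<omega> + Y \<omega>)) A =
        emeasure (density lborel (\<lambda>x. \<integral>\<^sup>+y. f (x - y) * g y \<partial>lborel)) A"
      by (simp add: emeasure_density nn_integral_multc)
  qed simp
  then show ?thesis
    by (simp add: distributed_def)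
qed

lemma matrix_add_rdistrib:
  fixes A :: "'a::semiring_1 ^ 'n ^ 'm"
  shows "(A + B) ** C = A ** C + B ** C"
  by (simp add: matrix_matrix_mult_def vec_eq_iff distrib_right sum.distrib)

text \<open>\<open>z = T g\<close> minimises \<open>(u - z) \<bullet> S\<^sup>-\<^sup>1 (u - z) + z \<bullet> T\<^sup>-\<^sup>1 z\<close>.\<close>
lemma sym_positive_definite_complete_square:
  fixes S T :: "real ^ 'n ^ 'n"
  assumes S: "sym_positive_definite S" and T: "sym_positive_definite T" and u: "u = (S + T) *v g"
  shows "(u - (T *v g + w)) \<bullet> (matrix_inv S *v (u - (T *v g + w))) + (T *v g + w) \<bullet> (matrix_inv T *v (T *v g + w))
    = u \<bullet> g + w \<bullet> ((matrix_inv S + matrix_inv T) *v w)"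
proof -
  have inv: "matrix_inv S *v (S *v x) = x" "S *v (matrix_inv S *v x) = x"
    "matrix_inv T *v (T *v x) = x" "T *v (matrix_inv T *v x) = x" for x
    by (simp_all add: matrix_inv_vector sym_positive_definite_invertible S T)
  have "u - (T *v g + w) = S *v g - w"
    by (simp add: u matrix_vector_mult_add_rdistrib)
  moreover have "(S *v g) \<bullet> (matrix_inv S *v w) = w \<bullet> g" "(T *v g) \<bullet> (matrix_inv T *v w) = w \<bullet> g"
    by (simp_all add: sym_positive_definite_inner_swap[OF S] sym_positive_definite_inner_swap[OF T] inv inner_commute)
  ultimately show ?thesis
    by (simp add: u inv matrix_vector_mult_diff_distrib matrix_vector_right_distrib
        matrix_vector_mult_add_rdistrib inner_add_left inner_add_right inner_diff_left inner_diff_right)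
qed

text \<open>Centring \<open>z\<close> at the minimiser of the combined exponent splits the integrand
  into a constant \<open>K\<close> and a Gaussian in the deviation \<open>w\<close> with matrix
  \<open>?R\<close>; only the Gaussian is integrated.\<close>

lemma convolution_multivariate_normal_density:
  fixes S T :: "real ^ 'n ^ 'n"
  assumes S: "sym_positive_definite S" and T: "sym_positive_definite T"
  shows "(\<integral>\<^sup>+z. ennreal (multivariate_normal_density m S (y - z)) *
      ennreal (multivariate_normal_density n T z) \<partial>lborel) =
    ennreal (multivariate_normal_density (m + n) (S + T) y)"
proof -
  define P where "P = (2 * pi) ^ CARD('n)"
  have P: "P > 0"
    by (simp add: P_def)
  note ST = sym_positive_definite_add[OF S T]
  let ?R = "matrix_inv S + matrix_inv T"
  have R: "sym_positive_definite ?R"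
    by (intro sym_positive_definite_add sym_positive_definite_matrix_inv S T)
  \<comment> \<open>This factorisation supplies \<open>det ?R\<close>, and with it the match between
    the normalising constants.\<close>
  have "S ** ?R ** T = S + T"
    using matrix_inv_mult[OF sym_positive_definite_invertible[OF S]]
      matrix_inv_mult[OF sym_positive_definite_invertible[OF T]]
    by (simp add: matrix_add_ldistrib matrix_add_rdistrib flip: matrix_mul_assoc)
  then have det: "det S * det ?R * det T = det (S + T)"
    by (metis det_mul)
  note pos = sym_positive_definite_det_pos[OF S] sym_positive_definite_det_pos[OF T]
    sym_positive_definite_det_pos[OF R] sym_positive_definite_det_pos[OF ST]
  \<comment> \<open>With these choices \<open>u \<bullet> g\<close> is the quadratic form in the
    exponent of the target density at \<open>y\<close>, and \<open>K\<close> collects all factors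
    independent of \<open>w\<close>.\<close>
  define u where "u = y - (m + n)"
  define g where "g = matrix_inv (S + T) *v u"
  have u: "u = (S + T) *v g"
    by (simp add: g_def matrix_inv_vector_right[OF sym_positive_definite_invertible[OF ST]])
  define K where "K = 1 / sqrt (P * det S) * (1 / sqrt (P * det T)) * exp (- (u \<bullet> g) / 2)"
  have K: "K \<ge> 0"
    using P pos by (simp add: K_def)
  have prod: "multivariate_normal_density m S (y - (n + T *v g + w)) *
      multivariate_normal_density n T (n + T *v g + w) = K * exp (- (w \<bullet> (?R *v w)) / 2)" for w
  proof -
    have arg: "y - (n + T *v g + w) - m = u - (T *v g + w)" "n + T *v g + w - n = T *v g + w"
      by (simp_all add: u_def algebra_simps)
    have "exp (- p / 2) * exp (- q / 2) = exp (- a / 2) * exp (- c / 2)" if "p + q = a + c" for p q a c :: real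
    proof -
      have "- p / 2 + - q / 2 = - a / 2 + - c / 2"
        using that by simp
      then show ?thesis
        by (metis exp_add)
    qed
    from this[OF sym_positive_definite_complete_square[OF S T u, of w]] show ?thesis
      unfolding multivariate_normal_density_def K_def P_def arg by (simp only: mult_ac)
  qed
  have "(\<integral>\<^sup>+z. ennreal (multivariate_normal_density m S (y - z)) *
      ennreal (multivariate_normal_density n T z) \<partial>lborel) =
      (\<integral>\<^sup>+w. ennreal (multivariate_normal_density m S (y - (n + T *v g + w))) *
        ennreal (multivariate_normal_density n T (n + T *v g + w)) \<partial>lborel)"
    by (rule nn_integral_lborel_translation[symmetric]) simp
  also have "\<dots> = (\<integral>\<^sup>+w. ennreal K * ennreal (exp (- (w \<bullet> (?R *v w)) / 2)) \<partial>lborel)"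
    using K by (simp add: prod multivariate_normal_density_nonneg S T flip: ennreal_mult)
  also have "\<dots> = ennreal K * (\<integral>\<^sup>+w. ennreal (exp (- (w \<bullet> (?R *v w)) / 2)) \<partial>lborel)"
    by (rule nn_integral_cmult)
      (auto intro!: borel_measurable_continuous_onI continuous_intros measurable_compose[OF _ measurable_ennreal])
  also have "\<dots> = ennreal K * ennreal (sqrt (P / det ?R))"
    unfolding nn_integral_gaussian[OF R] P_def ..
  also have "\<dots> = ennreal (multivariate_normal_density (m + n) (S + T) y)"
  proof -
    \<comment> \<open>\<open>a\<close>, \<open>c\<close>, \<open>r\<close> stand for the
      determinants of \<open>S\<close>, \<open>T\<close>, \<open>?R\<close>. Two factors
      \<open>sqrt P\<close> in denominators against one in a numerator leave a single one.\<close>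
    have "1 / sqrt (P * a) * (1 / sqrt (P * c)) * sqrt (P / r) = 1 / sqrt (P * (a * r * c))"
      if "a > 0" "c > 0" "r > 0" for a c r
      using P that by (simp add: real_sqrt_mult real_sqrt_divide divide_simps)
    from this[OF pos(1-3)]
    have "1 / sqrt (P * det S) * (1 / sqrt (P * det T)) * sqrt (P / det ?R) = 1 / sqrt (P * det (S + T))"
      unfolding det .
    moreover have "K * sqrt (P / det ?R) =
        1 / sqrt (P * det S) * (1 / sqrt (P * det T)) * sqrt (P / det ?R) * exp (- (u \<bullet> g) / 2)"
      by (simp only: K_def mult_ac)
    ultimately have "K * sqrt (P / det ?R) = multivariate_normal_density (m + n) (S + T) y"
      by (simp only: multivariate_normal_density_def g_def u_def P_def)
    moreover have "ennreal K * ennreal (sqrt (P / det ?R)) = ennreal (K * sqrt (P / det ?R))"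
      by (rule ennreal_mult[symmetric]) (use K P pos in auto)
    ultimately show ?thesis
      by simp
  qed
  finally show ?thesis .
qed

lemma (in prob_space) multivariate_normal_sum:
  assumes "indep_var borel X borel Y" "multivariate_normal M X m S" "multivariate_normal M Y n T"
  shows "multivariate_normal M (\<lambda>\<omega>. X \<omega> + Y \<omega>) (m + n) (S + T)"
proof -
  have S: "sym_positive_definite S" and T: "sym_positive_definite T"
    using assms by (simp_all add: multivariate_normal_def)
  have X: "distributed M lborel X (\<lambda>y. ennreal (multivariate_normal_density m S y))"
    and Y: "distributed M lborel Y (\<lambda>y. ennreal (multivariate_normal_density n T y))"
    using assms by (simp_all add: multivariate_normal_def)
  have "distributed M lborel (\<lambda>\<omega>. X \<omega> + Y \<omega>)
      (\<lambda>y. ennreal (multivariate_normal_density (m + n) (S + T) y))"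
    using distributed_convolution_euclidean[OF assms(1) X Y]
    unfolding convolution_multivariate_normal_density[OF S T] .
  then show ?thesis
    by (simp add: multivariate_normal_def sym_positive_definite_add S T)
qed

section \<open>The law of the Thompson Sampling sample\<close>

theorem proposition4:
  fixes M :: "'w measure"
    and x :: "'arm \<Rightarrow> real ^ 'd" and a :: "nat \<Rightarrow> 'arm" and r :: "nat \<Rightarrow> real"
    and t :: nat and l v \<sigma> :: real
    and A :: "real ^ 'd ^ 'd" and b \<theta>_hat :: "real ^ 'd"
    and \<eta> \<xi> b_tilde \<theta>_tilde :: "'w \<Rightarrow> real ^ 'd"
  assumes "prob_space M"
    and "t \<ge> 1" and "l > 0" and "v > 0" and "\<sigma> > 0"
    and "\<And>s. s \<in> {1..<t} \<Longrightarrow> r s \<in> {0..1}"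
    and "A = design_matrix l x a t"
    and "b = reward_vector x a r t"
    and "\<theta>_hat = matrix_inv A *v b"
    and "multivariate_normal M \<eta> 0 (\<sigma>\<^sup>2 *\<^sub>R mat 1)"
    and "multivariate_normal M \<xi> 0 (v\<^sup>2 *\<^sub>R matrix_inv A)"
    and "prob_space.indep_var M borel \<eta> borel \<xi>"
    and "b_tilde = (\<lambda>\<omega>. b + \<eta> \<omega>)"
    and "\<theta>_tilde = (\<lambda>\<omega>. matrix_inv A *v b_tilde \<omega> + \<xi> \<omega>)"
  shows "multivariate_normal M \<theta>_tilde \<theta>_hat
           (v\<^sup>2 *\<^sub>R matrix_inv A + \<sigma>\<^sup>2 *\<^sub>R (matrix_inv A ** matrix_inv A))"
proof -
  interpret prob_space M by fact
  let ?B = "matrix_inv A"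
  have scaled: "sym_positive_definite (v\<^sup>2 *\<^sub>R ?B)"
    using assms(11) by (simp add: multivariate_normal_def)
  \<comment> \<open>Positive definiteness of \<open>?B\<close> is read off from the law of
    \<open>\<xi>\<close>: \<open>multivariate_normal\<close> demands it of the covariance, and the
    positive factor \<open>v\<^sup>2\<close> cancels.\<close>
  have B: "sym_positive_definite ?B"
  proof -
    have "transpose (v\<^sup>2 *\<^sub>R ?B) = v\<^sup>2 *\<^sub>R transpose ?B"
      by (simp add: transpose_def vec_eq_iff)
    then have "transpose ?B = ?B"
      using sym_positive_definiteD(1)[OF scaled] \<open>v > 0\<close> by simp
    moreover have "y \<bullet> (?B *v y) > 0" if "y \<noteq> 0" for y
      using sym_positive_definiteD(2)[OF scaled that] \<open>v > 0\<close>
      unfolding scaleR_matrix_vector_assoc[symmetric] by (simp add: zero_less_mult_iff)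
    ultimately show ?thesis
      by (simp add: sym_positive_definite_def)
  qed
  \<comment> \<open>Symmetry of \<open>?B\<close> turns the covariance of the affine image of
    \<open>\<eta>\<close> into a multiple of the squared inverse.\<close>
  have cov: "?B ** (\<sigma>\<^sup>2 *\<^sub>R mat 1) ** transpose ?B = \<sigma>\<^sup>2 *\<^sub>R (?B ** ?B)"
    by (simp only: sym_positive_definiteD(1)[OF B] matrix_scalar_ac scalar_matrix_assoc[symmetric] matrix_mul_rid)
  have "multivariate_normal M (\<lambda>\<omega>. ?B *v b + ?B *v \<eta> \<omega>) \<theta>_hat (\<sigma>\<^sup>2 *\<^sub>R (?B ** ?B))"
    using multivariate_normal_affine[OF assms(10) sym_positive_definite_invertible[OF B], of "?B *v b"]
    by (simp add: cov assms(9))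
  moreover have "indep_var borel (\<lambda>\<omega>. ?B *v b + ?B *v \<eta> \<omega>) borel \<xi>"
  proof -
    \<comment> \<open>The first summand is a measurable function of \<open>\<eta>\<close> alone, so
      independence from \<open>\<xi>\<close> is inherited.\<close>
    have "(\<lambda>x. ?B *v b + ?B *v x) \<in> borel_measurable borel"
      by (intro borel_measurable_continuous_onI continuous_intros)
    from indep_var_compose[OF assms(12) this measurable_ident] show ?thesis
      by (simp only: comp_def id_def)
  qed
  ultimately have "multivariate_normal M (\<lambda>\<omega>. ?B *v b + ?B *v \<eta> \<omega> + \<xi> \<omega>) (\<theta>_hat + 0)
      (\<sigma>\<^sup>2 *\<^sub>R (?B ** ?B) + v\<^sup>2 *\<^sub>R ?B)"
    by (intro multivariate_normal_sum assms(11))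
  then show ?thesis
    unfolding assms(13,14) matrix_vector_right_distrib
    by (simp only: add_0_right add.commute[of "v\<^sup>2 *\<^sub>R ?B"])
qed

end
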